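(* Let $\mathcal H$ be a real Hilbert space. Suppose that $f\in\Gamma_0(\mathcal H)$ and $\operatorname{dom} f=\operatorname{dom}\partial f$. Then $f$ is strictly convex if and only if $\partial f$ is strictly monotone.
   Context: $\Gamma_0(\mathcal H)$ is the set of proper, lower semicontinuous, convex functions $f:\mathcal H\to\left]-\infty,+\infty\right]$; $\operatorname{dom} f=\{x: f(x)<+\infty\}$. The subdifferential is $\partial f(x)=\{v\in\mathcal H : f(y)\ge f(x)+\langle v,y-x\rangle\ \forall y\in\mathcal H\}$ and $\operatorname{dom}\partial f=\{x:\partial f(x)\neq\varnothing\}$. $f$ is strictly convex if $\operatorname{dom} f$ is convex and $f(\lambda x+(1-\lambda)y)<\lambda f(x)+(1-\lambda)f(y)$ for all $x\neq y$ in $\operatorname{dom} f$ and $\lambda\in\left]0,1\right[$. A set-valued operator $A:\mathcal H\to 2^{\mathcal H}$ is strictly monotone if $\langle x_0-x_1,v_0-v_1\rangle>0$ whenever $x_0\neq x_1$ and $v_i\in Ax_i$ ($i=0,1$). *)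

theory Defs
  imports "HOL-Analysis.Analysis"
begin

definition eff_dom :: "('a \<Rightarrow> ereal) \<Rightarrow> 'a set" where
  "eff_dom f = {x. f x < \<infinity>}"

definition proper_fun :: "('a \<Rightarrow> ereal) \<Rightarrow> bool" where
  "proper_fun f \<longleftrightarrow> (\<forall>x. f x \<noteq> -\<infinity>) \<and> eff_dom f \<noteq> {}"

definition lower_semicontinuous :: "('a::topological_space \<Rightarrow> ereal) \<Rightarrow> bool" where
  "lower_semicontinuous f \<longleftrightarrow> (\<forall>x. f x \<le> Liminf (at x) f)"

(* Meant for functions that omit -\<infinity>: ereal sets \<infinity> + (-\<infinity>) = \<infinity>.
   The endpoints l = 0 and l = 1 are left out, as in the usual definition for extended-real
   functions; there the inequality is trivial. *)
definition convex_fun :: "('a::real_vector \<Rightarrow> ereal) \<Rightarrow> bool" where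
  "convex_fun f \<longleftrightarrow>
    (\<forall>x y. \<forall>l\<in>{0<..<1::real}.
      f (l *\<^sub>R x + (1 - l) *\<^sub>R y) \<le> ereal l * f x + ereal (1 - l) * f y)"

definition Gamma0 :: "('a::real_inner \<Rightarrow> ereal) set" where
  "Gamma0 = {f. proper_fun f \<and> lower_semicontinuous f \<and> convex_fun f}"

definition strictly_convex_fun :: "('a::real_vector \<Rightarrow> ereal) \<Rightarrow> bool" where
  "strictly_convex_fun f \<longleftrightarrow>
    convex (eff_dom f) \<and>
    (\<forall>x\<in>eff_dom f. \<forall>y\<in>eff_dom f. \<forall>l\<in>{0<..<1::real}. x \<noteq> y \<longrightarrow>
      f (l *\<^sub>R x + (1 - l) *\<^sub>R y) < ereal l * f x + ereal (1 - l) * f y)"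

definition subdifferential :: "('a::real_inner \<Rightarrow> ereal) \<Rightarrow> 'a \<Rightarrow> 'a set" where
  "subdifferential f x = {v. \<forall>y. f y \<ge> f x + ereal (v \<bullet> (y - x))}"

(* A set-valued operator H \<rightarrow> 2^H is a function of type 'a \<Rightarrow> 'a set. *)
definition op_dom :: "('a \<Rightarrow> 'b set) \<Rightarrow> 'a set" where
  "op_dom A = {x. A x \<noteq> {}}"

definition strictly_monotone :: "('a::real_inner \<Rightarrow> 'a set) \<Rightarrow> bool" where
  "strictly_monotone A \<longleftrightarrow>
    (\<forall>x0 x1. \<forall>v0\<in>A x0. \<forall>v1\<in>A x1. x0 \<noteq> x1 \<longrightarrow> (x0 - x1) \<bullet> (v0 - v1) > 0)"

end

theory Submission
  imports Defs
begin

text \<open>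
  Strict convexity at the midpoint of \<open>x0\<close>, \<open>x1\<close>, combined with the two subgradient inequalities there,
  gives strict monotonicity. Conversely, if the strict inequality fails at \<open>z = l x + (1 - l) y\<close>, then a
  subgradient of \<open>f\<close> at \<open>z\<close> (it exists because \<open>z\<close> lies in the domain of \<open>f\<close>) yields an affine minorant
  that is also exact at \<open>x\<close>, so the subdifferentials at \<open>x \<noteq> z\<close> share an element.
\<close>

lemma proper_fun_real:
  assumes "proper_fun f" "x \<in> eff_dom f"
  obtains r where "f x = ereal r"
  using assms unfolding proper_fun_def eff_dom_def by (cases "f x") auto

text \<open>Properness supplies a point \<open>y\<close> where \<open>f\<close> is finite; the
  subgradient inequality tested at \<open>y\<close> rules out
  \<open>f x = \<infinity>\<close>.\<close>

lemma subdifferential_subset_eff_dom: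
  assumes "proper_fun f" "v \<in> subdifferential f x"
  shows "x \<in> eff_dom f"
proof -
  obtain y where y: "y \<in> eff_dom f"
    using assms(1) by (auto simp: proper_fun_def)
  have "f x + ereal (v \<bullet> (y - x)) \<le> f y"
    using assms(2) by (simp add: subdifferential_def)
  then show ?thesis
    using y by (auto simp: eff_dom_def)
qed

lemma convex_fun_eff_dom:
  assumes "convex_fun f" "x \<in> eff_dom f" "y \<in> eff_dom f" "0 < l" "l < 1"
  shows "l *\<^sub>R x + (1 - l) *\<^sub>R y \<in> eff_dom f"
proof -
  have "f (l *\<^sub>R x + (1 - l) *\<^sub>R y) \<le> ereal l * f x + ereal (1 - l) * f y"
    using assms(1,4,5) by (simp add: convex_fun_def)
  also have "\<dots> < \<infinity>"
    using assms(2-5) by (cases "f x"; cases "f y") (auto simp: eff_dom_def)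
  finally show ?thesis
    by (simp add: eff_dom_def)
qed

lemma convex_eff_dom:
  assumes "convex_fun f"
  shows "convex (eff_dom f)"
  unfolding convex_alt
proof (intro ballI allI impI)
  fix x y and u :: real
  assume xy: "x \<in> eff_dom f" "y \<in> eff_dom f" and u: "0 \<le> u \<and> u \<le> 1"
  \<comment> \<open>\<open>convex_fun\<close> speaks only of weights strictly between 0 and 1, so
    the endpoints are treated apart.\<close>
  consider "u = 0" | "u = 1" | "0 < u" "u < 1"
    using u by linarith
  then show "(1 - u) *\<^sub>R x + u *\<^sub>R y \<in> eff_dom f"
    using xy convex_fun_eff_dom[OF assms xy(2) xy(1), of u] by cases (auto simp: add.commute)
qed

lemma strictly_convex_fun_imp_strictly_monotone:
  assumes "proper_fun f" "strictly_convex_fun f"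
  shows "strictly_monotone (subdifferential f)"
  unfolding strictly_monotone_def
proof (intro allI ballI impI)
  fix x y v w
  assume v: "v \<in> subdifferential f x" and w: "w \<in> subdifferential f y" and "x \<noteq> y"
  define m where "m = (1/2) *\<^sub>R x + (1 - 1/2) *\<^sub>R y"
  have x: "x \<in> eff_dom f" and y: "y \<in> eff_dom f"
    using subdifferential_subset_eff_dom[OF assms(1)] v w by auto
  obtain a where a: "f x = ereal a" using proper_fun_real[OF assms(1) x] .
  obtain b where b: "f y = ereal b" using proper_fun_real[OF assms(1) y] .
  have "f m < ereal (1/2) * f x + ereal (1 - 1/2) * f y"
  proof -
    have "(1/2::real) \<in> {0<..<1}"
      by simp
    then show ?thesis
      unfolding m_def using assms(2) x y \<open>x \<noteq> y\<close> unfolding strictly_convex_fun_def by blast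
  qed
  then have lt: "f m < ereal (a/2 + b/2)"
    by (simp add: a b)
  then have "m \<in> eff_dom f"
    by (auto simp: eff_dom_def)
  then obtain c where c: "f m = ereal c" using proper_fun_real[OF assms(1)] by blast
  have "f x + ereal (v \<bullet> (m - x)) \<le> f m" "f y + ereal (w \<bullet> (m - y)) \<le> f m"
    using v w by (auto simp: subdifferential_def)
  then have "a + v \<bullet> (m - x) \<le> c" "b + w \<bullet> (m - y) \<le> c" "c < a/2 + b/2"
    using lt by (auto simp: a b c)
  \<comment> \<open>At the midpoint, \<open>m - x\<close> and \<open>m - y\<close> are opposite
    vectors, so adding the two subgradient inequalities leaves only the monotonicity term:
    \<open>a + b - ((x - y) \<bullet> (v - w)) / 2 \<le> 2 * c < a + b\<close>.\<close>
  moreover have "v \<bullet> (m - x) + w \<bullet> (m - y) = - ((x - y) \<bullet> (v - w)) / 2"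
    by (simp add: m_def inner_simps inner_commute field_simps)
  ultimately show "(x - y) \<bullet> (v - w) > 0"
    by linarith
qed

lemma strictly_monotone_imp_strictly_convex_fun:
  assumes "proper_fun f" "convex_fun f" "eff_dom f \<subseteq> op_dom (subdifferential f)"
    and mono: "strictly_monotone (subdifferential f)"
  shows "strictly_convex_fun f"
  unfolding strictly_convex_fun_def
proof (intro conjI ballI impI)
  show "convex (eff_dom f)"
    using assms(2) by (rule convex_eff_dom)
next
  fix x y and l :: real
  assume x: "x \<in> eff_dom f" and y: "y \<in> eff_dom f" and l: "l \<in> {0<..<1}" and "x \<noteq> y"
  define z where "z = l *\<^sub>R x + (1 - l) *\<^sub>R y"
  have z: "z \<in> eff_dom f"
    unfolding z_def using convex_fun_eff_dom[OF assms(2) x y] l by simp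
  obtain a where a: "f x = ereal a" using proper_fun_real[OF assms(1) x] .
  obtain b where b: "f y = ereal b" using proper_fun_real[OF assms(1) y] .
  obtain c where c: "f z = ereal c" using proper_fun_real[OF assms(1) z] .
  obtain u where u: "u \<in> subdifferential f z"
    using z assms(3) by (auto simp: op_dom_def)
  show "f (l *\<^sub>R x + (1 - l) *\<^sub>R y) < ereal l * f x + ereal (1 - l) * f y"
  proof (rule ccontr)
    assume "\<not> ?thesis"
    then have le: "l * a + (1 - l) * b \<le> c"
      by (simp add: z_def[symmetric] a b c not_less)
    have "f z + ereal (u \<bullet> (y - z)) \<le> f y"
      using u by (auto simp: subdifferential_def)
    then have "c + u \<bullet> (y - z) \<le> b"
      by (simp add: b c)
    then have "(1 - l) * (c + u \<bullet> (y - z)) \<le> (1 - l) * b"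
      using l by (intro mult_left_mono) auto
    \<comment> \<open>Since \<open>z\<close> is the weighted mean of \<open>x\<close> and
      \<open>y\<close>, the weighted displacements cancel. This turns the upper bound on the
      minorant at \<open>y\<close> into a lower bound at \<open>x\<close>.\<close>
    moreover have "l * (u \<bullet> (x - z)) + (1 - l) * (u \<bullet> (y - z)) = 0"
      by (simp add: z_def inner_simps algebra_simps)
    ultimately have "l * a \<le> l * (c + u \<bullet> (x - z))"
      using le by (simp add: algebra_simps)
    then have exact: "a \<le> c + u \<bullet> (x - z)"
      using l by simp
    \<comment> \<open>By \<open>exact\<close>, moving the base point of the affine minorant of slope
      \<open>u\<close> from \<open>z\<close> to \<open>x\<close> does not raise it, so it stays
      below \<open>f\<close>.\<close>
    have "f x + ereal (u \<bullet> (w - x)) \<le> f w" for w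
    proof -
      have "f x + ereal (u \<bullet> (w - x)) \<le> f z + ereal (u \<bullet> (w - z))"
        using exact by (simp add: a c inner_simps)
      also have "\<dots> \<le> f w"
        using u by (simp add: subdifferential_def)
      finally show ?thesis .
    qed
    then have "u \<in> subdifferential f x"
      by (simp add: subdifferential_def)
    \<comment> \<open>As \<open>l < 1\<close>, the points \<open>x\<close> and \<open>z\<close>
      differ; with the common subgradient \<open>u\<close>, strict monotonicity would make
      \<open>(x - z) \<bullet> 0\<close> positive.\<close>
    moreover have "x - z = (1 - l) *\<^sub>R (x - y)"
      by (simp add: z_def algebra_simps)
    then have "x \<noteq> z"
      using l \<open>x \<noteq> y\<close> by auto
    ultimately have "(x - z) \<bullet> (u - u) > 0"
      using mono u unfolding strictly_monotone_def by blast
    then show False by simp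
  qed
qed

theorem corollary5p9:
  fixes f :: "'h::{real_inner, complete_space} \<Rightarrow> ereal"
  assumes "f \<in> Gamma0"
    and "eff_dom f = op_dom (subdifferential f)"
  shows "strictly_convex_fun f \<longleftrightarrow> strictly_monotone (subdifferential f)"
  using assms strictly_convex_fun_imp_strictly_monotone[of f]
    strictly_monotone_imp_strictly_convex_fun[of f]
  by (auto simp: Gamma0_def)

end
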